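(* Suppose $G$ is a finite subgroup of $GL_3(\mathbb{R})$ that is strictly generated in codimension two. Then $\mathcal L(\mathcal{A}^G)$ is isomorphic, as a poset, to $\mathcal L_n$ for some $n\neq 2$. More precisely, for any positive integer $n\neq 2$, there exists a finite subgroup $G\subset GL_3(\mathbb{R})$, strictly generated in codimension two, such that $\mathcal L(\mathcal{A}^G)\cong \mathcal L_n$.
   Context: Let $V=\mathbb R^3$ and $G\subset GL(V)$ finite. For $g\in G$, $V^{\langle g\rangle}$ is the subspace of vectors fixed by $g$; for a subgroup $H\subset G$, $V^H$ is the subspace of vectors fixed by every element of $H$. $G$ is strictly generated in codimension two if it is generated by its elements $g$ with $\operatorname{codim}V^{\langle g\rangle}=2$. A subgroup $H\subset G$ is a stabilizer subgroup if $H=\{g\in G\mid gv=v\ \text{for all } v\in V^H\}$. The subspace arrangement of $G$ is $\mathcal A^G=\{V^H\mid \{e\}\neq H \text{ a stabilizer subgroup}\}$. The lattice of intersections $\mathcal L(\mathcal A^G)$ is the set of all intersections of subfamilies of $\mathcal A^G$ (the empty intersection being $V$), ordered by reverse inclusion. $\mathcal L_n$ denotes the poset consisting of a minimum $\hat 0$, a maximum $\hat 1$, and $n$ pairwise incomparable elements $l_1,\dots,l_n$ with $\hat 0<l_i<\hat 1$ for all $i$.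
   Formalization: The trivial group is excluded (its lattice is one point, not any L_n), and n = 1 is dropped from the existence claim because no such G has the three-element chain L_1; nontrivial cyclic groups give L_0, so n = 0 is included and the first part yields n ≠ 1, 2. *)

theory Defs
  imports "HOL-Analysis.Analysis" "HOL-Algebra.Generated_Groups" "HOL-Algebra.Order"
begin

definition GL :: "(real^'n^'n) monoid" where
  "GL = \<lparr>carrier = {A. invertible A}, mult = (**), one = mat 1\<rparr>"

definition fixed_space :: "(real^'n^'n) set \<Rightarrow> (real^'n) set" where
  "fixed_space H = {v. \<forall>g\<in>H. g *v v = v}"

definition codim :: "(real^'n) set \<Rightarrow> nat" where
  "codim W = DIM(real^'n) - dim W"

definition strictly_generated_in_codim :: "nat \<Rightarrow> (real^'n^'n) set \<Rightarrow> bool" where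
  "strictly_generated_in_codim k G \<longleftrightarrow>
     generate GL {g \<in> G. codim (fixed_space (generate GL {g})) = k} = G"

definition stabilizer_subgroup :: "(real^'n^'n) set \<Rightarrow> (real^'n^'n) set \<Rightarrow> bool" where
  "stabilizer_subgroup G H \<longleftrightarrow>
     subgroup H GL \<and> H \<subseteq> G \<and> H = {g \<in> G. \<forall>v\<in>fixed_space H. g *v v = v}"

definition subspace_arrangement :: "(real^'n^'n) set \<Rightarrow> (real^'n) set set" where
  "subspace_arrangement G =
     {fixed_space H | H. stabilizer_subgroup G H \<and> H \<noteq> {mat 1}}"

text \<open>The empty subfamily is allowed below; its intersection is the whole space \<^term>\<open>UNIV\<close>.\<close>

definition intersection_lattice :: "'a set set \<Rightarrow> 'a set gorder" where
  "intersection_lattice \<A> =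
     \<lparr>carrier = {\<Inter>\<B> | \<B>. \<B> \<subseteq> \<A>}, eq = (=), le = (\<lambda>X Y. Y \<subseteq> X)\<rparr>"

datatype L_elem = Bottom | Middle nat | Top

text \<open>Bottom and top are distinct for every \<open>n\<close>. Thus \<open>L_poset 0\<close> is a chain with two elements
  and \<open>L_poset 1\<close> is a chain with three elements.\<close>

definition L_poset :: "nat \<Rightarrow> L_elem gorder" where
  "L_poset n =
     \<lparr>carrier = {Bottom, Top} \<union> Middle ` {1..n}, eq = (=),
      le = (\<lambda>x y. x = y \<or> x = Bottom \<or> y = Top)\<rparr>"

definition poset_isomorphic :: "'a gorder \<Rightarrow> 'b gorder \<Rightarrow> bool" where
  "poset_isomorphic P Q \<longleftrightarrow>
     (\<exists>f. bij_betw f (carrier P) (carrier Q) \<and>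
          (\<forall>x\<in>carrier P. \<forall>y\<in>carrier P. x \<sqsubseteq>\<^bsub>P\<^esub> y \<longleftrightarrow> f x \<sqsubseteq>\<^bsub>Q\<^esub> f y))"

end

theory Submission
  imports Defs
begin

text \<open>A finite \<open>G\<close> preserves an inner product. For an orthogonal \<open>g\<close> of \<open>\<real>\<^sup>3\<close> with
  one-dimensional fixed space, \<open>det g = 1\<close>; conversely every \<open>g \<noteq> 1\<close> of determinant one is a
  rotation and fixes exactly a line. So a group strictly generated in codimension two consists of
  rotations, its arrangement consists of the axes and of \<open>V\<^sup>G\<close>, and distinct axes meet in \<open>0\<close>.
  Exactly two axes are impossible: the stabilizers of the axes would be two proper subgroups with
  union \<open>G\<close>. All other numbers of axes are attained by a cyclic group of order two and by the
  dihedral groups: the one of order \<open>2m\<close>, \<open>m \<ge> 2\<close>, has \<open>m + 1\<close> axes.\<close>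

section \<open>The matrix group and fixed spaces\<close>

lemma GL_simps [simp]:
  "carrier GL = {A :: real^'n^'n. invertible A}"
  "x \<otimes>\<^bsub>GL\<^esub> y = (x :: real^'n^'n) ** y"
  "\<one>\<^bsub>GL\<^esub> = (mat 1 :: real^'n^'n)"
  by (simp_all add: GL_def)

lemma group_GL: "group (GL :: (real^'n^'n) monoid)"
proof (rule groupI)
  fix x :: "real^'n^'n" assume "x \<in> carrier GL"
  then obtain y where "x ** y = mat 1" "y ** x = mat 1"
    by (auto simp: invertible_def)
  then show "\<exists>y\<in>carrier GL. y \<otimes>\<^bsub>GL\<^esub> x = \<one>\<^bsub>GL\<^esub>"
    by (intro bexI[of _ y]) (auto simp: invertible_def)
next
  show "\<one>\<^bsub>GL\<^esub> \<in> carrier (GL :: (real^'n^'n) monoid)"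
    by (auto simp: invertible_def)
qed (auto simp: invertible_mult matrix_mul_assoc)

lemma GL_inv: "invertible (g :: real^'n^'n) \<Longrightarrow> inv\<^bsub>GL\<^esub> g ** g = mat 1"
  using group.l_inv[OF group_GL, of g] by simp

text \<open>A square matrix with a left inverse is invertible, so left inverses inside
  \<open>G\<close> give both the inclusion in the general linear group and closure under
  inverses.\<close>

lemma subgroup_GLI:
  assumes "mat 1 \<in> G" "\<And>x y. x \<in> G \<Longrightarrow> y \<in> G \<Longrightarrow> x ** y \<in> G"
    and "\<And>x. x \<in> G \<Longrightarrow> \<exists>y\<in>G. y ** x = (mat 1 :: real^'n^'n)"
  shows "subgroup G GL"
proof
  show *: "G \<subseteq> carrier GL"
    using assms(3) by (auto simp: invertible_left_inverse)
  fix x assume x: "x \<in> G"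
  then obtain y where y: "y \<in> G" "y ** x = mat 1" using assms(3) by blast
  then have "inv\<^bsub>GL\<^esub> x = y"
    using x * by (intro group.inv_equality[OF group_GL]) auto
  then show "inv\<^bsub>GL\<^esub> x \<in> G" using y by simp
qed (use assms in auto)

text \<open>Products and inverses of elements fixing a vector fix it too. This turns the codimension
  condition, phrased with the cyclic group of \<open>g\<close>, into one on \<open>g\<close>
  alone.\<close>

lemma fixed_space_generate:
  assumes "invertible (g :: real^'n^'n)"
  shows "fixed_space (generate GL {g}) = fixed_space {g}"
proof
  show "fixed_space (generate GL {g}) \<subseteq> fixed_space {g}"
    by (auto simp: fixed_space_def intro: generate.incl)
  show "fixed_space {g} \<subseteq> fixed_space (generate GL {g})"
  proof
    fix v assume "v \<in> fixed_space {g}"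
    then have v: "g *v v = v" by (simp add: fixed_space_def)
    have "h *v v = v" if "h \<in> generate GL {g}" for h
      using that
    proof induction
      case (inv h)
      then have "inv\<^bsub>GL\<^esub> h *v (h *v v) = v"
        using GL_inv[OF assms] by (simp add: matrix_vector_mul_assoc)
      then show ?case using inv v by simp
    next
      case (eng h1 h2)
      then show ?case by (simp flip: matrix_vector_mul_assoc)
    qed (use v in auto)
    then show "v \<in> fixed_space (generate GL {g})" by (simp add: fixed_space_def)
  qed
qed

lemma subspace_fixed_space: "subspace (fixed_space (H :: (real^'n^'n) set))"
  by (auto simp: subspace_def fixed_space_def matrix_vector_right_distrib
      matrix_vector_mult_scaleR)

lemma zero_mem_fixed_space: "0 \<in> fixed_space H"
  by (simp add: fixed_space_def)

section \<open>Kernels and lines\<close>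

lemma det_eq_0_imp_kernel:
  fixes A :: "real^'n^'n"
  assumes "det A = 0"
  obtains x where "x \<noteq> 0" "A *v x = 0"
  using assms invertible_det_nz[of A] matrix_left_invertible_ker[of A]
  by (auto simp: invertible_left_inverse)

lemma dim_eq_1_span:
  fixes S :: "'a::euclidean_space set"
  assumes "subspace S" "dim S = 1"
  obtains u where "u \<noteq> 0" "S = span {u}"
proof -
  obtain B where B: "B \<subseteq> S" "independent B" "S \<subseteq> span B" "card B = dim S"
    using basis_exists by blast
  then obtain u where "B = {u}" using assms by (auto simp: card_1_singleton_iff)
  with B have "u \<noteq> 0" "S \<subseteq> span {u}" "{u} \<subseteq> S"
    by (auto simp: dependent_zero)
  moreover have "span {u} \<subseteq> S"
    using \<open>{u} \<subseteq> S\<close> assms(1) by (rule span_minimal)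
  ultimately show ?thesis using that by blast
qed

text \<open>A nonzero common vector would span each of the two lines and make them equal.\<close>

lemma span_singletons_meet:
  fixes u v :: "'a::real_vector"
  assumes "span {u} \<noteq> span {v}"
  shows "span {u} \<inter> span {v} = {0}"
proof -
  have "x = 0" if "x \<in> span {u}" "x \<in> span {v}" for x
  proof (rule ccontr)
    assume "x \<noteq> 0"
    have "span {x} = span {w}" if "x \<in> span {w}" for w
    proof -
      from that obtain c where c: "x = c *\<^sub>R w" unfolding span_singleton by blast
      then have "c \<noteq> 0" using \<open>x \<noteq> 0\<close> by auto
      then have "w = (1/c) *\<^sub>R x" using c by simp
      then have "w \<in> span {x}" by (metis span_base span_scale singletonI)
      then show ?thesis using that by (simp add: span_eq)
    qed
    then show False using that assms by metis
  qed
  then show ?thesis by (auto simp: span_zero)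
qed

section \<open>The invariant inner product of a finite matrix group\<close>

text \<open>There is no division by the order: a positive factor affects neither invariance nor
  definiteness.\<close>

definition avg_inner :: "(real^'n^'n) set \<Rightarrow> real^'n \<Rightarrow> real^'n \<Rightarrow> real" where
  "avg_inner G x y = (\<Sum>h\<in>G. (h *v x) \<bullet> (h *v y))"

lemma avg_inner_commute: "avg_inner G x y = avg_inner G y x"
  by (simp add: avg_inner_def inner_commute)

lemma avg_inner_add_left: "avg_inner G (x + y) z = avg_inner G x z + avg_inner G y z"
  by (simp add: avg_inner_def matrix_vector_right_distrib inner_left_distrib sum.distrib)

lemma avg_inner_scale_left: "avg_inner G (c *\<^sub>R x) z = c * avg_inner G x z"
  by (simp add: avg_inner_def matrix_vector_mult_scaleR sum_distrib_left)

lemma avg_inner_add_right: "avg_inner G z (x + y) = avg_inner G z x + avg_inner G z y"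
  by (metis avg_inner_commute avg_inner_add_left)

lemma avg_inner_scale_right: "avg_inner G z (c *\<^sub>R x) = c * avg_inner G z x"
  by (metis avg_inner_commute avg_inner_scale_left)

lemmas avg_inner_linear =
  avg_inner_add_left avg_inner_scale_left avg_inner_add_right avg_inner_scale_right

locale finite_matrix_group =
  fixes G :: "(real^'n^'n) set"
  assumes fin: "finite G" and sub: "subgroup G GL"
begin

lemma one_mem: "mat 1 \<in> G"
  using subgroup.one_closed[OF sub] by simp

lemma mult_mem: "g \<in> G \<Longrightarrow> h \<in> G \<Longrightarrow> g ** h \<in> G"
  using subgroup.m_closed[OF sub] by simp

lemma inv_mem: "g \<in> G \<Longrightarrow> inv\<^bsub>GL\<^esub> g \<in> G"
  using subgroup.m_inv_closed[OF sub] .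

lemma mem_invertible: "g \<in> G \<Longrightarrow> invertible g"
  using subgroup.subset[OF sub] by auto

lemma inv_mult: "g \<in> G \<Longrightarrow> inv\<^bsub>GL\<^esub> g ** g = mat 1"
  by (simp add: GL_inv mem_invertible)

lemma mult_inv: "g \<in> G \<Longrightarrow> g ** inv\<^bsub>GL\<^esub> g = mat 1"
  using inv_mult matrix_left_right_inverse by blast

text \<open>Right multiplication by \<open>g\<close> permutes \<open>G\<close>, hence only reorders
  the sum.\<close>

lemma avg_inner_invariant:
  assumes "g \<in> G"
  shows "avg_inner G (g *v x) (g *v y) = avg_inner G x y"
  unfolding avg_inner_def
proof (rule sum.reindex_bij_witness[where i = "\<lambda>h. h ** inv\<^bsub>GL\<^esub> g" and j = "\<lambda>h. h ** g"])
qed (use assms in \<open>simp_all add: mult_mem inv_mem inv_mult mult_inv matrix_vector_mul_assoc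
      flip: matrix_mul_assoc\<close>)

text \<open>All summands are nonnegative, and the one for the identity is the squared length of
  \<open>x\<close>.\<close>

lemma avg_inner_self_eq_0: "avg_inner G x x = 0 \<longleftrightarrow> x = 0"
proof
  assume "avg_inner G x x = 0"
  then have "\<forall>h\<in>G. (h *v x) \<bullet> (h *v x) = 0"
    unfolding avg_inner_def by (subst (asm) sum_nonneg_eq_0_iff) (auto simp: fin)
  then show "x = 0" using one_mem by fastforce
qed (simp add: avg_inner_def)

text \<open>Since \<open>y v* h\<close> is the transpose of \<open>h\<close> applied to
  \<open>y\<close>, this is the sum of the matrices \<open>transpose h ** h\<close>, the Gram matrix
  of the averaged form.\<close>

definition gram :: "real^'n^'n" where
  "gram = matrix (\<lambda>x. \<Sum>h\<in>G. (h *v x) v* h)"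

lemma avg_inner_gram: "avg_inner G x y = (gram *v x) \<bullet> y"
proof -
  have "linear (\<lambda>x. \<Sum>h\<in>G. (h *v x) v* h)"
    by (intro linear_compose_sum)
      (auto intro!: linearI simp: matrix_vector_right_distrib vector_matrix_left_distrib
        matrix_vector_mult_scaleR scaleR_vector_matrix_assoc)
  then show ?thesis
    by (simp add: gram_def matrix_works avg_inner_def inner_sum_left dot_lmul_matrix)
qed

lemma det_gram: "det gram \<noteq> 0"
proof
  assume "det gram = 0"
  then obtain x where "x \<noteq> 0" "gram *v x = 0" by (rule det_eq_0_imp_kernel)
  then show False using avg_inner_gram[of x x] avg_inner_self_eq_0 by simp
qed

text \<open>Invariance of the form as an identity of matrices, to which determinants can be
  applied.\<close>

lemma gram_invariant:
  assumes "g \<in> G"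
  shows "transpose g ** gram ** g = gram"
proof -
  have "((gram *v (g *v x)) v* g) \<bullet> y = (gram *v x) \<bullet> y" for x y
    using avg_inner_invariant[OF assms, of x y] by (simp add: avg_inner_gram dot_lmul_matrix)
  then have "(gram *v (g *v x)) v* g = gram *v x" for x
    by (metis vector_eq_rdot)
  then show ?thesis
    by (simp add: matrix_eq flip: matrix_vector_mul_assoc)
qed

lemma det_cases:
  assumes "g \<in> G"
  shows "det g = 1 \<or> det g = -1"
proof -
  have "det g * det gram * det g = det gram"
    by (metis gram_invariant[OF assms] det_mul det_transpose)
  then have "(det g)\<^sup>2 = 1" using det_gram by (simp add: power2_eq_square)
  then show ?thesis by (simp add: power2_eq_1_iff)
qed

end

section \<open>Eigenvectors in dimension three\<close>

lemma det_scaleR_3: "det (c *\<^sub>R X) = c ^ 3 * det (X :: real^3^3)"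
  by (simp add: det_3 power3_eq_cube algebra_simps)

locale finite_matrix_group3 = finite_matrix_group G for G :: "(real^3^3) set"
begin

text \<open>Invariance of the Gram matrix \<open>M\<close> gives \<open>g\<^sup>T M (g - d) = M - d g\<^sup>T M = - d (g - d)\<^sup>T M\<close> for
  \<open>d = det g = \<plusminus>1\<close>, and in odd dimension taking determinants forces \<open>det (g - d) = 0\<close>.\<close>

lemma det_is_eigenvalue:
  assumes g: "g \<in> G"
  obtains x where "x \<noteq> 0" "g *v x = det g *\<^sub>R x"
proof -
  let ?d = "det g"
  let ?A = "g - mat ?d"
  have d: "?d * ?d = 1" using det_cases[OF g] by auto
  have T: "transpose ?A = transpose g - mat ?d"
    by (auto simp: transpose_def mat_def vec_eq_iff)
  have m: "X ** (Y - mat c) = X ** Y - c *\<^sub>R X" "(Y - mat c) ** X = Y ** X - c *\<^sub>R X"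
    for c and X Y :: "real^3^3"
    by (auto simp: matrix_matrix_mult_def mat_def vec_eq_iff sum_3 forall_3 algebra_simps)
  have "transpose g ** gram ** ?A = (- ?d) *\<^sub>R (transpose ?A ** gram)"
    unfolding T m gram_invariant[OF g] using d by (simp add: scaleR_right_diff_distrib)
  then have "det (transpose g ** gram ** ?A) = det ((- ?d) *\<^sub>R (transpose ?A ** gram))" by simp
  also have "\<dots> = (- ?d) ^ 3 * det (transpose ?A ** gram)"
    by (rule det_scaleR_3)
  finally have "?d * det gram * det ?A = (- ?d) ^ 3 * (det ?A * det gram)"
    by (simp add: det_mul)
  moreover have "(- ?d) ^ 3 = - ?d" using d by (simp add: power3_eq_cube)
  ultimately have "det ?A = 0" using d det_gram by auto
  then obtain x where "x \<noteq> 0" "?A *v x = 0" by (rule det_eq_0_imp_kernel)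
  moreover have "mat ?d *v x = ?d *\<^sub>R x"
    by (auto simp: matrix_vector_mult_def mat_def vec_eq_iff sum_3 forall_3)
  ultimately show ?thesis
    using that by (simp add: matrix_vector_mult_diff_rdistrib)
qed

text \<open>The form is invariant, so the orthogonal complement of the \<open>g\<close>-stable plane
  of \<open>u\<close> and \<open>w\<close> is stable as well; in dimension three it is a line and
  supplies the third eigenvector.\<close>

lemma complete_eigenbasis:
  assumes g: "g \<in> G" and uw: "u \<noteq> 0" "w \<noteq> 0" "avg_inner G u w = 0"
    and eig: "g *v u = a *\<^sub>R u" "g *v w = b *\<^sub>R w" "a \<noteq> 0" "b \<noteq> 0"
  obtains z c where "z \<noteq> 0" "avg_inner G u z = 0" "g *v z = c *\<^sub>R z" "det g = a * b * c"
    "\<forall>v. \<exists>x y t. v = x *\<^sub>R u + y *\<^sub>R w + t *\<^sub>R z"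
proof -
  note lin = avg_inner_linear avg_inner_self_eq_0
  \<comment> \<open>Standard orthogonality to \<open>gram *v u\<close> and \<open>gram *v w\<close>
    is orthogonality to \<open>u\<close> and \<open>w\<close> for the averaged form. Two vectors
    cannot span the space, so a nonzero \<open>z\<close> exists.\<close>
  have "dim {gram *v u, gram *v w} \<le> card {gram *v u, gram *v w}"
    by (rule dim_le_card') simp
  also have "\<dots> < DIM(real^3)" by (simp add: card_insert_if)
  finally obtain z where z: "z \<noteq> 0"
    "\<And>y. y \<in> span {gram *v u, gram *v w} \<Longrightarrow> orthogonal z y"
    using orthogonal_to_subspace_exists by blast
  have uz: "avg_inner G u z = 0" and wz: "avg_inner G w z = 0"
    using z(2)[of "gram *v u"] z(2)[of "gram *v w"]
    by (auto simp: avg_inner_gram orthogonal_def inner_commute span_base)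
  note orth = uw(3) uz wz uw(3)[unfolded avg_inner_commute[of G u w]]
    uz[unfolded avg_inner_commute[of G u z]] wz[unfolded avg_inner_commute[of G w z]]
  \<comment> \<open>The columns of \<open>P\<close> are \<open>u\<close>, \<open>w\<close> and
    \<open>z\<close>; nonzero pairwise orthogonal columns make it invertible.\<close>
  define P :: "real^3^3"
    where "P = (\<chi> i j. if j = 1 then u $ i else if j = 2 then w $ i else z $ i)"
  have P: "P *v x = x $ 1 *\<^sub>R u + x $ 2 *\<^sub>R w + x $ 3 *\<^sub>R z" for x
    by (simp add: P_def matrix_vector_mult_def vec_eq_iff sum_3)
  have detP: "det P \<noteq> 0"
  proof
    assume "det P = 0"
    then obtain x where x: "x \<noteq> 0" "P *v x = 0" by (rule det_eq_0_imp_kernel)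
    have "avg_inner G (P *v x) y = 0" for y
      using x by (simp add: avg_inner_gram)
    from this[of u] this[of w] this[of z] have "x $ 1 = 0" "x $ 2 = 0" "x $ 3 = 0"
      using uw z(1) by (simp_all add: P lin orth)
    then show False using x by (simp add: vec_eq_iff forall_3)
  qed
  then obtain Q where Q: "P ** Q = mat 1"
    unfolding invertible_det_nz[symmetric] invertible_def by blast
  have spans: "\<exists>x y t. v = x *\<^sub>R u + y *\<^sub>R w + t *\<^sub>R z" for v
    using P[of "Q *v v"] Q by (auto simp: matrix_vector_mul_assoc)
  then obtain x y c where gz: "g *v z = x *\<^sub>R u + y *\<^sub>R w + c *\<^sub>R z" by blast
  \<comment> \<open>Pairing \<open>g *v z\<close> with \<open>g *v u\<close> gives
    \<open>avg_inner G z u\<close>, which is zero, and \<open>g *v u\<close> is a multiple of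
    \<open>u\<close>; likewise for \<open>w\<close>.\<close>
  have "a * avg_inner G (g *v z) u = 0" "b * avg_inner G (g *v z) w = 0"
    using avg_inner_invariant[OF g, of z u] avg_inner_invariant[OF g, of z w] eig
    by (simp_all add: lin orth)
  then have "x = 0" "y = 0"
    using eig uw by (simp_all add: gz lin orth)
  with gz have gz: "g *v z = c *\<^sub>R z" by simp
  \<comment> \<open>\<open>g ** P\<close> is \<open>P\<close> with its columns scaled by the
    eigenvalues.\<close>
  have "(g ** P) $ i $ j = (if j = 1 then a else if j = 2 then b else c) * P $ i $ j" for i j
    using arg_cong[OF eig(1), of "\<lambda>v. v $ i"] arg_cong[OF eig(2), of "\<lambda>v. v $ i"]
      arg_cong[OF gz, of "\<lambda>v. v $ i"]
    by (simp add: P_def matrix_matrix_mult_def matrix_vector_mult_def sum_3)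
  then have "det (g ** P) = a * b * c * det P"
    by (simp add: det_3 algebra_simps)
  then have "det g = a * b * c" using detP by (simp add: det_mul)
  then show ?thesis using that z(1) uz gz spans by blast
qed

text \<open>With determinant -1 there would be an eigenvector for -1, orthogonal to the fixed line.
  The determinant then makes the third eigenvalue 1, giving a fixed vector off that line.\<close>

lemma det_eq_1_if_dim_fixed_eq_1:
  assumes g: "g \<in> G" and dim: "dim (fixed_space {g}) = 1"
  shows "det g = 1"
proof (rule ccontr)
  assume "det g \<noteq> 1"
  then have d: "det g = -1" using det_cases[OF g] by simp
  obtain u where u: "u \<noteq> 0" "fixed_space {g} = span {u}"
    using dim_eq_1_span[OF subspace_fixed_space dim] .
  then have gu: "g *v u = u" by (auto simp: fixed_space_def set_eq_iff span_base)
  obtain w where w: "w \<noteq> 0" "g *v w = - w"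
    using det_is_eigenvalue[OF g] d by auto
  have "avg_inner G u w = - avg_inner G u w"
    using avg_inner_invariant[OF g, of u w] avg_inner_scale_right[of G u "-1" w]
    by (simp add: gu w)
  then have uw: "avg_inner G u w = 0" by simp
  have e: "g *v u = 1 *\<^sub>R u" "g *v w = (-1) *\<^sub>R w" "(1::real) \<noteq> 0" "(-1::real) \<noteq> 0"
    using gu w by simp_all
  obtain z c where z: "z \<noteq> 0" "avg_inner G u z = 0" "g *v z = c *\<^sub>R z" "det g = 1 * (-1) * c"
    and "\<forall>v. \<exists>x y t. v = x *\<^sub>R u + y *\<^sub>R w + t *\<^sub>R z"
    by (rule complete_eigenbasis[OF g u(1) w(1) uw e])
  then have "g *v z = z" using d by simp
  then have "z \<in> span {u}" using u by (auto simp: fixed_space_def)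
  then obtain k where k: "z = k *\<^sub>R u" unfolding span_singleton by blast
  have "k * avg_inner G u u = 0"
    using z(2) unfolding k avg_inner_scale_right .
  then show False using z(1) u(1) k by (simp add: avg_inner_self_eq_0)
qed

text \<open>Determinant one makes 1 an eigenvalue. If two orthogonal nonzero fixed vectors existed,
  the third eigenvalue would be 1 as well and \<open>g\<close> would be the identity.\<close>

lemma fixed_space_is_line:
  assumes g: "g \<in> G" "g \<noteq> mat 1" and d: "det g = 1"
  obtains u where "u \<noteq> 0" "fixed_space {g} = span {u}"
proof -
  obtain u where u: "u \<noteq> 0" "g *v u = u"
    using det_is_eigenvalue[OF g(1)] d by auto
  have span: "v \<in> span {u}" if "g *v v = v" for v
  proof -
    \<comment> \<open>Gram-Schmidt coefficient: \<open>w\<close> is the component of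
      \<open>v\<close> orthogonal to \<open>u\<close>, and is again fixed.\<close>
    define k where "k = avg_inner G u v / avg_inner G u u"
    define w where "w = v + (- k) *\<^sub>R u"
    have gw: "g *v w = w"
      using u that unfolding w_def by (simp only: matrix_vector_right_distrib matrix_vector_mult_scaleR)
    have uw: "avg_inner G u w = 0"
      using u unfolding w_def avg_inner_linear by (simp add: k_def avg_inner_self_eq_0)
    have "w = 0"
    proof (rule ccontr)
      assume w: "w \<noteq> 0"
      have e: "g *v u = 1 *\<^sub>R u" "g *v w = 1 *\<^sub>R w" "(1::real) \<noteq> 0" "(1::real) \<noteq> 0"
        using u gw by simp_all
      obtain z c where "z \<noteq> 0" "avg_inner G u z = 0" and z: "g *v z = c *\<^sub>R z" "det g = 1 * 1 * c"
        and span: "\<forall>v. \<exists>x y t. v = x *\<^sub>R u + y *\<^sub>R w + t *\<^sub>R z"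
        by (rule complete_eigenbasis[OF g(1) u(1) w uw e])
      from z have "g *v z = z" using d by simp
      have "g *v v = v" for v
      proof -
        obtain x y t where v: "v = x *\<^sub>R u + y *\<^sub>R w + t *\<^sub>R z" using span by blast
        show ?thesis
          unfolding v matrix_vector_right_distrib matrix_vector_mult_scaleR u(2) gw \<open>g *v z = z\<close> ..
      qed
      then show False using g(2) by (simp add: matrix_eq)
    qed
    then have "v = k *\<^sub>R u" by (simp add: w_def)
    then show ?thesis by (auto simp: span_singleton)
  qed
  have "span {u} \<subseteq> fixed_space {g}"
    using u by (intro span_minimal subspace_fixed_space) (simp add: fixed_space_def)
  moreover have "fixed_space {g} \<subseteq> span {u}"
    using span by (simp add: fixed_space_def subset_iff)
  ultimately have "fixed_space {g} = span {u}" by simp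
  then show ?thesis by (rule that[OF u(1)])
qed

end

section \<open>Lattices of arrangements with a common pairwise intersection\<close>

text \<open>Two distinct members of \<open>A\<close> always meet in \<open>T\<close>, so the only
  intersections are the whole space, from the empty family, and the members themselves. Reverse
  inclusion puts \<open>UNIV\<close> at the bottom and \<open>T\<close> at the top.\<close>

lemma poset_isomorphic_L_poset:
  assumes A: "A = insert T S" and fin: "finite S"
    and T: "T \<noteq> UNIV" "T \<notin> S" "\<And>l. l \<in> S \<Longrightarrow> T \<subseteq> l"
    and S: "UNIV \<notin> S" "\<And>l m. l \<in> S \<Longrightarrow> m \<in> S \<Longrightarrow> l \<noteq> m \<Longrightarrow> l \<inter> m = T"
  shows "poset_isomorphic (intersection_lattice A) (L_poset (card S))"
proof -
  have 1: "\<Inter>B \<in> insert UNIV A" if B: "B \<subseteq> A" for B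
  proof (cases "B = {}")
    case False
    then obtain l where l: "l \<in> B" by blast
    show ?thesis
    proof (cases "B = {l}")
      case True
      then show ?thesis using B by simp
    next
      case False
      then obtain m where m: "m \<in> B" "l \<noteq> m" using l by blast
      have "l \<in> insert T S" "m \<in> insert T S" using l m B A by auto
      then have "l \<inter> m = T" using S(2)[of l m] T(3)[of l] T(3)[of m] m(2) by auto
      moreover have "T \<subseteq> \<Inter>B" using B A T(3) by auto
      moreover have "\<Inter>B \<subseteq> l \<inter> m" using l m by (simp add: Inter_lower)
      ultimately show ?thesis using A by simp
    qed
  qed simp
  have 2: "\<exists>B. X = \<Inter>B \<and> B \<subseteq> A" if "X \<in> insert UNIV A" for X
    using that by (cases "X = UNIV") (auto intro: exI[of _ "{}"] exI[of _ "{X}"])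
  have "{\<Inter>B | B. B \<subseteq> A} = insert UNIV A"
  proof (intro equalityI subsetI)
    fix X assume "X \<in> {\<Inter>B | B. B \<subseteq> A}"
    then show "X \<in> insert UNIV A" using 1 by (elim CollectE exE conjE) simp
  qed (use 2 in simp)
  then have carrier: "carrier (intersection_lattice A) = {UNIV, T} \<union> S"
    by (simp add: intersection_lattice_def A)
  have "\<exists>h. bij_betw h S {1..card S}"
    using fin by (intro finite_same_card_bij) auto
  then obtain h where h: "inj_on h S" "h ` S = {1..card S}" unfolding bij_betw_def by blast
  define f where "f X = (if X = UNIV then Bottom else if X = T then Top else Middle (h X))" for X
  have f: "f UNIV = Bottom" "f T = Top" "\<And>l. l \<in> S \<Longrightarrow> f l = Middle (h l)"
    using T S by (auto simp: f_def)
  have inj: "h l = h m \<longleftrightarrow> l = m" if "l \<in> S" "m \<in> S" for l m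
    using h that by (simp add: inj_on_eq_iff)
  have "f ` S = (\<lambda>l. Middle (h l)) ` S" using f(3) by (rule image_cong[OF refl])
  then have "f ` S = Middle ` {1..card S}" by (simp only: h(2)[symmetric] image_image)
  then have "f ` ({UNIV, T} \<union> S) = carrier (L_poset (card S))"
    by (simp add: L_poset_def f(1,2) insert_commute)
  moreover have "inj_on f ({UNIV, T} \<union> S)"
  proof (rule inj_onI)
    fix X Y assume "X \<in> {UNIV, T} \<union> S" "Y \<in> {UNIV, T} \<union> S" "f X = f Y"
    then show "X = Y" by (elim UnE insertE emptyE) (simp_all add: f inj)
  qed
  ultimately have bij: "bij_betw f ({UNIV, T} \<union> S) (carrier (L_poset (card S)))"
    by (simp add: bij_betw_def)
  have not_le: "\<not> UNIV \<subseteq> T" "\<And>l. l \<in> S \<Longrightarrow> \<not> l \<subseteq> T" "\<And>l. l \<in> S \<Longrightarrow> \<not> UNIV \<subseteq> l"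
    using T S(1) by (auto simp: top.extremum_unique dest: subset_antisym)
  \<comment> \<open>A containment between distinct members would make the smaller one equal to the
    intersection \<open>T\<close>.\<close>
  have antichain: "m \<subseteq> l \<longleftrightarrow> l = m" if "l \<in> S" "m \<in> S" for l m
    using S(2)[OF that] not_le(2)[OF that(2)] by auto
  have "Y \<subseteq> X \<longleftrightarrow> f X \<sqsubseteq>\<^bsub>L_poset (card S)\<^esub> f Y" if "X \<in> {UNIV, T} \<union> S" "Y \<in> {UNIV, T} \<union> S" for X Y
    using that
    by (elim UnE insertE emptyE) (simp_all add: L_poset_def f inj antichain not_le T(3))
  with bij show ?thesis
    unfolding poset_isomorphic_def carrier
    by (intro exI[of _ f]) (simp add: intersection_lattice_def)
qed

section \<open>Axes of a rotation group\<close>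

definition axes :: "(real^'n^'n) set \<Rightarrow> (real^'n) set set" where
  "axes G = (\<lambda>g. fixed_space {g}) ` (G - {mat 1})"

text \<open>Determinant one replaces strict generation in codimension two; for finite subgroups of
  \<open>GL\<close> in dimension three the two conditions are shown below to be equivalent.\<close>

locale rotation_group = finite_matrix_group3 +
  assumes det_1: "\<And>g. g \<in> G \<Longrightarrow> det g = 1"
begin

lemma axes_span:
  assumes "l \<in> axes G"
  obtains u where "u \<noteq> 0" "l = span {u}"
  using assms fixed_space_is_line det_1 unfolding axes_def by blast

lemma dim_axis: "l \<in> axes G \<Longrightarrow> dim l = 1"
  by (metis axes_span dim_span dim_singleton)

lemma axes_meet: "l \<in> axes G \<Longrightarrow> m \<in> axes G \<Longrightarrow> l \<noteq> m \<Longrightarrow> l \<inter> m = {0}"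
  by (metis axes_span span_singletons_meet)

lemma fixed_space_subset_axis: "l \<in> axes G \<Longrightarrow> fixed_space G \<subseteq> l"
  by (auto simp: axes_def fixed_space_def)

text \<open>Vectors fixed by all of \<open>G\<close> lie on both axes, and two distinct axes share
  only the origin.\<close>

lemma fixed_space_eq_0:
  assumes "l \<in> axes G" "m \<in> axes G" "l \<noteq> m"
  shows "fixed_space G = {0}"
proof
  show "fixed_space G \<subseteq> {0}"
    using axes_meet[OF assms] fixed_space_subset_axis[OF assms(1)] fixed_space_subset_axis[OF assms(2)]
    by blast
qed (simp add: zero_mem_fixed_space)

text \<open>Every nontrivial element fixes exactly a line, so it is itself one of the
  generators.\<close>

lemma strictly_generated: "strictly_generated_in_codim 2 G"
  unfolding strictly_generated_in_codim_def
proof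
  let ?X = "{g \<in> G. codim (fixed_space (generate GL {g})) = 2}"
  show "generate GL ?X \<subseteq> G"
    by (rule group.generate_subgroup_incl[OF group_GL _ sub]) blast
  show "G \<subseteq> generate GL ?X"
  proof
    fix g assume g: "g \<in> G"
    show "g \<in> generate GL ?X"
    proof (cases "g = mat 1")
      case True
      then show ?thesis using generate.one[of GL ?X] by simp
    next
      case False
      then have "dim (fixed_space {g}) = 1" using g by (intro dim_axis) (auto simp: axes_def)
      then have "g \<in> ?X" using g by (simp add: fixed_space_generate mem_invertible codim_def)
      then show ?thesis by (rule generate.incl)
    qed
  qed
qed

text \<open>If the nontrivial elements of a stabilizer share one axis, its fixed space is that axis;
  if two axes occur, it is zero, and so is the fixed space of \<open>G\<close>.\<close>

lemma subspace_arrangement_eq: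
  assumes "G \<noteq> {mat 1}"
  shows "subspace_arrangement G = insert (fixed_space G) (axes G)"
proof (intro equalityI subsetI)
  fix X assume "X \<in> subspace_arrangement G"
  then obtain H where H: "X = fixed_space H" "subgroup H GL" "H \<subseteq> G" "H \<noteq> {mat 1}"
    by (auto simp: subspace_arrangement_def stabilizer_subgroup_def)
  have "mat 1 \<in> H" using subgroup.one_closed[OF H(2)] by simp
  then obtain h where h: "h \<in> H" "h \<noteq> mat 1" using H(4) by blast
  then have hax: "fixed_space {h} \<in> axes G" using H(3) by (auto simp: axes_def)
  show "X \<in> insert (fixed_space G) (axes G)"
  proof (cases "\<forall>k\<in>H - {mat 1}. fixed_space {k} = fixed_space {h}")
    case True
    have "fixed_space {h} \<subseteq> fixed_space H"
    proof
      fix v assume v: "v \<in> fixed_space {h}"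
      have "k *v v = v" if "k \<in> H" for k
      proof (cases "k = mat 1")
        case False
        then have "v \<in> fixed_space {k}" using True that v by blast
        then show ?thesis by (simp add: fixed_space_def)
      qed simp
      then show "v \<in> fixed_space H" by (simp add: fixed_space_def)
    qed
    moreover have "fixed_space H \<subseteq> fixed_space {h}" using h by (auto simp: fixed_space_def)
    ultimately show ?thesis using H(1) hax by auto
  next
    case False
    then obtain k where k: "k \<in> H" "k \<noteq> mat 1" "fixed_space {k} \<noteq> fixed_space {h}" by blast
    then have kax: "fixed_space {k} \<in> axes G" using H(3) by (auto simp: axes_def)
    have "X \<subseteq> fixed_space {k} \<inter> fixed_space {h}"
      using H(1) h k by (auto simp: fixed_space_def)
    then have "X = {0}"
      using axes_meet[OF kax hax k(3)] zero_mem_fixed_space H(1) by blast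
    then show ?thesis using fixed_space_eq_0[OF kax hax k(3)] by simp
  qed
next
  fix X assume "X \<in> insert (fixed_space G) (axes G)"
  then consider "X = fixed_space G" | g where "g \<in> G" "g \<noteq> mat 1" "X = fixed_space {g}"
    by (auto simp: axes_def)
  then show "X \<in> subspace_arrangement G"
  proof cases
    case 1
    have "stabilizer_subgroup G G"
      using sub by (auto simp: stabilizer_subgroup_def fixed_space_def)
    then show ?thesis using 1 assms by (auto simp: subspace_arrangement_def)
  next
    case 2
    \<comment> \<open>The pointwise stabilizer of the axis contains \<open>g\<close>, so it fixes no
      more than the axis.\<close>
    define H where "H = {h \<in> G. \<forall>v\<in>X. h *v v = v}"
    have g: "g \<in> H" using 2 by (simp add: H_def fixed_space_def)
    have "subgroup H GL"
    proof (rule subgroup_GLI)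
      fix x assume x: "x \<in> H"
      have "inv\<^bsub>GL\<^esub> x *v v = v" if "v \<in> X" for v
      proof -
        have "inv\<^bsub>GL\<^esub> x *v v = inv\<^bsub>GL\<^esub> x *v (x *v v)" using x that by (simp add: H_def)
        then show ?thesis using x inv_mult by (simp add: H_def matrix_vector_mul_assoc)
      qed
      then have "inv\<^bsub>GL\<^esub> x \<in> H" using x inv_mem by (simp add: H_def)
      then show "\<exists>y\<in>H. y ** x = mat 1" using x inv_mult by (auto simp: H_def)
    qed (auto simp: H_def one_mem mult_mem simp flip: matrix_vector_mul_assoc)
    moreover have fH: "fixed_space H = X"
      using g 2 by (auto simp: fixed_space_def H_def)
    ultimately have "stabilizer_subgroup G H"
      by (auto simp: stabilizer_subgroup_def H_def)
    moreover have "H \<noteq> {mat 1}" using g 2 by blast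
    ultimately show ?thesis using fH by (auto simp: subspace_arrangement_def)
  qed
qed

text \<open>\<open>fixed_space G\<close> is the top element, so it must not count as a middle one;
  it is an axis exactly when all nontrivial elements share one.\<close>

theorem intersection_lattice_iso:
  assumes "G \<noteq> {mat 1}"
  shows "poset_isomorphic (intersection_lattice (subspace_arrangement G))
           (L_poset (card (axes G - {fixed_space G})))"
proof (rule poset_isomorphic_L_poset)
  show "subspace_arrangement G = insert (fixed_space G) (axes G - {fixed_space G})"
    using subspace_arrangement_eq[OF assms] by simp
  show "finite (axes G - {fixed_space G})" using fin by (simp add: axes_def)
  have "dim (UNIV :: (real^3) set) = 3" by simp
  then show "UNIV \<notin> axes G - {fixed_space G}" using dim_axis[of UNIV] by auto
  obtain g where "g \<in> G" "g \<noteq> mat 1" using assms one_mem by blast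
  then have "fixed_space {g} \<in> axes G" by (auto simp: axes_def)
  then show "fixed_space G \<noteq> UNIV"
    using fixed_space_subset_axis[of "fixed_space {g}"] dim_axis[of "fixed_space {g}"]
    by (auto simp: top.extremum_unique)
  show "l \<inter> m = fixed_space G"
    if "l \<in> axes G - {fixed_space G}" "m \<in> axes G - {fixed_space G}" "l \<noteq> m" for l m
    using that axes_meet[of l m] fixed_space_eq_0[of l m] by simp
qed (use fixed_space_subset_axis in auto)

text \<open>A second axis would force \<open>fixed_space G\<close> to be zero, whereas an axis has
  dimension one.\<close>

lemma fixed_space_not_axis:
  assumes "l \<in> axes G" "l \<noteq> fixed_space G"
  shows "fixed_space G \<notin> axes G"
proof
  assume T: "fixed_space G \<in> axes G"
  then have "fixed_space G = {0}" using fixed_space_eq_0[OF assms(1) T assms(2)] by simp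
  then show False using dim_axis[OF T] by simp
qed

text \<open>The axes \<open>l\<close> and \<open>m\<close> may coincide, which treats both values at
  once. Every element fixes one of them pointwise, but a product \<open>g ** h\<close> with
  \<open>g\<close> not fixing \<open>l\<close> and \<open>h\<close> not fixing \<open>m\<close>
  could fix neither.\<close>

lemma card_axes_ne_1_2:
  "card (axes G - {fixed_space G}) \<noteq> 1" (is "?n \<noteq> 1") "card (axes G - {fixed_space G}) \<noteq> 2"
proof -
  have "?n \<noteq> 1 \<and> ?n \<noteq> 2"
  proof (rule ccontr)
    assume "\<not> ?thesis"
    then obtain l m where lm: "axes G - {fixed_space G} = {l, m}"
      unfolding card_1_singleton_iff One_nat_def card_2_iff by (metis insert_absorb2)
    then have "l \<in> axes G - {fixed_space G}" by simp
    then have "l \<in> axes G" "l \<noteq> fixed_space G" by simp_all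
    then have T: "fixed_space G \<notin> axes G" by (rule fixed_space_not_axis)
    with lm have ax: "axes G = {l, m}" by simp
    \<comment> \<open>An axis fixed pointwise by all of \<open>G\<close> would equal
      \<open>fixed_space G\<close>, which is not an axis.\<close>
    have not_all: "\<exists>g\<in>G. \<not> x \<subseteq> fixed_space {g}" if "x \<in> axes G" for x
    proof (rule ccontr)
      assume "\<not> ?thesis"
      then have "x \<subseteq> fixed_space G" by (auto simp: fixed_space_def)
      then have "x = fixed_space G" using fixed_space_subset_axis[OF that] by (rule subset_antisym)
      then show False using T that by simp
    qed
    obtain g where g: "g \<in> G" "\<not> l \<subseteq> fixed_space {g}"
      using not_all[of l] ax by auto
    obtain h where h: "h \<in> G" "\<not> m \<subseteq> fixed_space {h}"
      using not_all[of m] ax by auto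
    have cases: "l \<subseteq> fixed_space {k} \<or> m \<subseteq> fixed_space {k}" if "k \<in> G" for k
    proof (cases "k = mat 1")
      case True
      then show ?thesis by (simp add: fixed_space_def)
    next
      case False
      then have "fixed_space {k} \<in> {l, m}" using that unfolding ax[symmetric] axes_def by blast
      then show ?thesis by blast
    qed
    have cancel_left: "x \<subseteq> fixed_space {h}" if "x \<subseteq> fixed_space {g ** h}" "x \<subseteq> fixed_space {g}" for x
    proof
      fix v assume "v \<in> x"
      then have "v \<in> fixed_space {g ** h}" "v \<in> fixed_space {g}" using that by blast+
      then have "g *v (h *v v) = v" "g *v v = v" by (simp_all add: fixed_space_def matrix_vector_mul_assoc)
      then have "inv\<^bsub>GL\<^esub> g *v (g *v (h *v v)) = inv\<^bsub>GL\<^esub> g *v (g *v v)" by simp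
      then show "v \<in> fixed_space {h}"
        unfolding matrix_vector_mul_assoc matrix_mul_assoc inv_mult[OF g(1)] by (simp add: fixed_space_def)
    qed
    have cancel_right: "x \<subseteq> fixed_space {g}" if "x \<subseteq> fixed_space {g ** h}" "x \<subseteq> fixed_space {h}" for x
    proof
      fix v assume "v \<in> x"
      then have "v \<in> fixed_space {g ** h}" "v \<in> fixed_space {h}" using that by blast+
      then show "v \<in> fixed_space {g}" by (simp add: fixed_space_def flip: matrix_vector_mul_assoc)
    qed
    \<comment> \<open>As \<open>h\<close> fixes \<open>l\<close> and \<open>g\<close> fixes
      \<open>m\<close>, a product fixing \<open>l\<close> would make \<open>g\<close> fix
      \<open>l\<close>, and one fixing \<open>m\<close> would make \<open>h\<close> fix
      \<open>m\<close>.\<close>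
    have "m \<subseteq> fixed_space {g}" "l \<subseteq> fixed_space {h}"
      using cases[OF g(1)] cases[OF h(1)] g h by simp_all
    with cases[OF mult_mem[OF g(1) h(1)]] cancel_left cancel_right g h show False by metis
  qed
  then show "?n \<noteq> 1" "?n \<noteq> 2" by auto
qed

end

section \<open>From generators to determinant one\<close>

text \<open>Codimension two in dimension three means a fixed line, so the generators have
  determinant one, and this passes to products and inverses.\<close>

lemma rotation_group_if_strictly_generated:
  assumes fin: "finite G" and sub: "subgroup G GL" and gen: "strictly_generated_in_codim 2 G"
  shows "rotation_group G"
proof -
  interpret finite_matrix_group3 G
    by (intro finite_matrix_group3.intro finite_matrix_group.intro fin sub)
  let ?X = "{g \<in> G. codim (fixed_space (generate GL {g})) = 2}"
  have X: "det g = 1" "invertible g" if "g \<in> ?X" for g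
  proof -
    have g: "g \<in> G" using that by simp
    then show "invertible g" by (rule mem_invertible)
    then have "3 - dim (fixed_space {g}) = 2"
      using that by (simp add: fixed_space_generate codim_def)
    \<comment> \<open>Truncated subtraction is harmless: the positive difference 2 determines the
      dimension.\<close>
    then have "dim (fixed_space {g}) = 1" by arith
    then show "det g = 1" using g by (rule det_eq_1_if_dim_fixed_eq_1[rotated])
  qed
  have "det g = 1" if "g \<in> generate GL ?X" for g
    using that
  proof induction
    case (inv h)
    have "det (inv\<^bsub>GL\<^esub> h) * det h = 1"
      using GL_inv[OF X(2)[OF inv]] by (metis det_I det_mul)
    then show ?case using X(1)[OF inv] by simp
  qed (use X in \<open>auto simp: det_mul\<close>)
  then show ?thesis
    using gen by unfold_locales (simp add: strictly_generated_in_codim_def)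
qed

section \<open>Explicit rotations and half turns\<close>

definition rot :: "real \<Rightarrow> real^3^3" where
  "rot t = vector [vector [cos t, - sin t, 0], vector [sin t, cos t, 0], vector [0, 0, 1]]"

text \<open>\<open>half_turn t\<close> is the half turn about the horizontal line at angle \<open>t / 2\<close>.\<close>

definition half_turn :: "real \<Rightarrow> real^3^3" where
  "half_turn t = vector [vector [cos t, sin t, 0], vector [sin t, - cos t, 0], vector [0, 0, -1]]"

text \<open>The addition formulas give the multiplication table of the orthogonal group of the
  plane, whose reflections extend to space as half turns by reversing the third coordinate.\<close>

lemma rot_half_turn_mult:
  "rot s ** rot t = rot (s + t)" "rot s ** half_turn t = half_turn (s + t)"
  "half_turn s ** rot t = half_turn (s - t)" "half_turn s ** half_turn t = rot (s - t)"
  by (simp_all add: rot_def half_turn_def vec_eq_iff forall_3 matrix_matrix_mult_def sum_3 vector_3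
      sin_add cos_add sin_diff cos_diff)

lemma rot_0: "rot 0 = mat 1"
  by (simp add: rot_def vec_eq_iff forall_3 mat_def vector_3)

lemma det_rot: "det (rot t) = 1" and det_half_turn: "det (half_turn t) = 1"
  using sin_cos_squared_add[of t]
  by (simp_all add: rot_def half_turn_def det_3 vector_3 power2_eq_square algebra_simps)

lemma rot_axis: "axis 3 1 \<in> fixed_space {rot t}"
  by (simp add: fixed_space_def rot_def vec_eq_iff forall_3 matrix_vector_mult_def sum_3 vector_3 axis_def)

lemma half_turn_axis: "axis 3 1 \<notin> fixed_space {half_turn t}"
proof -
  have "(half_turn t *v axis 3 1) $ 3 \<noteq> (axis 3 1 :: real^3) $ 3"
    by (simp add: half_turn_def matrix_vector_mult_def sum_3 vector_3 axis_def)
  then show ?thesis by (auto simp: fixed_space_def)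
qed

lemma half_turn_neq_1: "half_turn t \<noteq> mat 1"
  by (simp add: half_turn_def vec_eq_iff forall_3 mat_def vector_3)

lemma rot_eq_1_iff: "rot t = mat 1 \<longleftrightarrow> cos t = 1"
  by (auto simp: rot_def vec_eq_iff forall_3 mat_def vector_3 cos_one_sin_zero)

text \<open>\<open>half_turn t\<close> sends the horizontal direction at angle \<open>y\<close> to
  the one at angle \<open>t - y\<close>. The direction at \<open>s/2\<close> lies on the axis of
  \<open>half_turn s\<close>; if \<open>half_turn t\<close> fixes it too, \<open>s/2\<close> and
  \<open>t - s/2\<close> agree up to full turns.\<close>

lemma fixed_space_half_turn_eqD:
  assumes "fixed_space {half_turn s} = fixed_space {half_turn t}"
  obtains n :: int where "s = t + 2 * pi * n"
proof -
  have *: "half_turn x *v vector [cos y, sin y, 0] = vector [cos (x - y), sin (x - y), 0 :: real]" for x y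
    by (simp add: half_turn_def vec_eq_iff forall_3 matrix_vector_mult_def sum_3 vector_3 sin_diff cos_diff)
  have "vector [cos (s/2), sin (s/2), 0] \<in> fixed_space {half_turn s}"
    unfolding fixed_space_def by (simp add: *)
  then have "half_turn t *v vector [cos (s/2), sin (s/2), 0] = vector [cos (s/2), sin (s/2), 0]"
    unfolding assms by (simp add: fixed_space_def)
  then have "sin (s/2) = sin (t - s/2) \<and> cos (s/2) = cos (t - s/2)"
    unfolding * by (simp add: vec_eq_iff forall_3 vector_3)
  then obtain n :: int where "s/2 = t - s/2 + 2 * pi * n" unfolding sin_cos_eq_iff by blast
  then show ?thesis using that[of n] by simp
qed

text \<open>The fixed space is a line by the general theory, and it contains the third basis
  vector.\<close>

lemma fixed_space_rot:
  assumes "rotation_group G" "rot t \<in> G" "rot t \<noteq> mat 1"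
  shows "fixed_space {rot t} = span {axis 3 1}"
proof -
  interpret rotation_group G by fact
  have "fixed_space {rot t} \<in> axes G" using assms by (auto simp: axes_def)
  then obtain u where u: "fixed_space {rot t} = span {u}" by (rule axes_span)
  have "axis 3 (1::real) \<in> span {u} \<inter> span {axis 3 1}" using rot_axis[of t] by (simp add: u span_base)
  moreover have "axis 3 (1::real) \<noteq> (0 :: real^3)" by (simp add: axis_eq_0_iff)
  ultimately show ?thesis using span_singletons_meet[of u "axis 3 1"] u by fastforce
qed

lemma rotation_groupI:
  assumes "finite G" "subgroup G (GL :: (real^3^3) monoid)" "\<And>g. g \<in> G \<Longrightarrow> det g = 1"
  shows "rotation_group G"
  by (intro rotation_group.intro finite_matrix_group3.intro finite_matrix_group.intro
      rotation_group_axioms.intro assms)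

section \<open>Dihedral groups and their axes\<close>

definition dihedral :: "nat \<Rightarrow> (real^3^3) set" where
  "dihedral m = range (\<lambda>k::int. rot (2 * pi * k / m)) \<union> range (\<lambda>k::int. half_turn (2 * pi * k / m))"

text \<open>The two angles differ by \<open>k div int m\<close> full turns. Hence finitely many
  indices suffice.\<close>

lemma angle_mod:
  assumes "m > 0"
  shows "rot (2 * pi * of_int k / real m) = rot (2 * pi * of_int (k mod int m) / real m)"
    "half_turn (2 * pi * of_int k / real m) = half_turn (2 * pi * of_int (k mod int m) / real m)"
proof -
  have "2 * pi * of_int k / real m
      = 2 * pi * of_int (k mod int m) / real m + 2 * pi * of_int (k div int m)"
  proof -
    have "of_int k = real m * of_int (k div int m) + (of_int (k mod int m) :: real)"
      by (metis mult_div_mod_eq of_int_add of_int_mult of_int_of_nat_eq)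
    then show ?thesis using assms by (simp add: field_simps)
  qed
  then have "sin (2 * pi * of_int k / real m) = sin (2 * pi * of_int (k mod int m) / real m)
      \<and> cos (2 * pi * of_int k / real m) = cos (2 * pi * of_int (k mod int m) / real m)"
    unfolding sin_cos_eq_iff by blast
  then show "rot (2 * pi * of_int k / real m) = rot (2 * pi * of_int (k mod int m) / real m)"
    "half_turn (2 * pi * of_int k / real m) = half_turn (2 * pi * of_int (k mod int m) / real m)"
    by (simp_all only: rot_def half_turn_def)
qed

lemma dihedral_eq:
  assumes "m > 0"
  shows "dihedral m = (\<lambda>k::int. rot (2 * pi * k / m)) ` {0..<int m}
           \<union> (\<lambda>k::int. half_turn (2 * pi * k / m)) ` {0..<int m}"
proof -
  have "k mod int m \<in> {0..<int m}" for k using assms by simp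
  then have "range (\<lambda>k::int. rot (2 * pi * k / m)) = (\<lambda>k::int. rot (2 * pi * k / m)) ` {0..<int m}"
    "range (\<lambda>k::int. half_turn (2 * pi * k / m)) = (\<lambda>k::int. half_turn (2 * pi * k / m)) ` {0..<int m}"
    using angle_mod[OF assms] by blast+
  then show ?thesis by (simp only: dihedral_def)
qed

lemma rotation_group_dihedral:
  assumes "m > 0"
  shows "rotation_group (dihedral m)"
proof (rule rotation_groupI)
  show "finite (dihedral m)" by (simp add: dihedral_eq assms)
  let ?a = "\<lambda>k::int. 2 * pi * k / m"
  have mem: "rot (?a k) \<in> dihedral m" "half_turn (?a k) \<in> dihedral m" for k
    by (auto simp: dihedral_def)
  have add: "?a j + ?a k = ?a (j + k)" "?a j - ?a k = ?a (j - k)" for j k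
    by (simp_all add: algebra_simps flip: add_divide_distrib diff_divide_distrib)
  have cases: "\<exists>k. x = rot (?a k) \<or> x = half_turn (?a k)" if "x \<in> dihedral m" for x
    using that by (auto simp: dihedral_def)
  show "subgroup (dihedral m) GL"
  proof (rule subgroup_GLI)
    show "mat 1 \<in> dihedral m" using mem(1)[of 0] by (simp add: rot_0)
    fix x assume "x \<in> dihedral m"
    then obtain k where k: "x = rot (?a k) \<or> x = half_turn (?a k)" using cases by blast
    \<comment> \<open>The inverse of a rotation has the opposite index; a half turn is its own
      inverse.\<close>
    have "rot (?a (- k)) ** rot (?a k) = mat 1" "half_turn (?a k) ** half_turn (?a k) = mat 1"
      unfolding rot_half_turn_mult add by (simp_all add: rot_0)
    then show "\<exists>y\<in>dihedral m. y ** x = mat 1" using k mem by metis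
  next
    fix x y assume "x \<in> dihedral m" "y \<in> dihedral m"
    then obtain j k where "x = rot (?a j) \<or> x = half_turn (?a j)" "y = rot (?a k) \<or> y = half_turn (?a k)"
      using cases by metis
    then show "x ** y \<in> dihedral m"
      by (elim disjE) (simp_all only: rot_half_turn_mult add mem)
  qed
  show "det g = 1" if "g \<in> dihedral m" for g
    using cases[OF that] det_rot det_half_turn by metis
qed

text \<open>The rotations contribute the vertical axis and the half turns \<open>m\<close> distinct
  horizontal ones. Distinct axes force the common fixed space to be zero, so no axis is
  removed.\<close>

lemma card_axes_dihedral:
  assumes "m \<ge> 2"
  shows "card (axes (dihedral m) - {fixed_space (dihedral m)}) = m + 1"
proof -
  let ?a = "\<lambda>k::int. 2 * pi * k / m"
  let ?F = "\<lambda>k. fixed_space {half_turn (?a k)}"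
  have m: "m > 0" using assms by simp
  interpret rotation_group "dihedral m" using m by (rule rotation_group_dihedral)
  have mem: "rot (?a k) \<in> dihedral m" "half_turn (?a k) \<in> dihedral m" for k
    by (auto simp: dihedral_def)
  \<comment> \<open>The bound \<open>m \<ge> 2\<close> ensures that one step is not a full turn, so
    the vertical axis does occur.\<close>
  have rot1: "rot (?a 1) \<noteq> mat 1"
  proof
    assume "rot (?a 1) = mat 1"
    then obtain n :: int where "2 * pi / real m = n * 2 * pi"
      unfolding rot_eq_1_iff cos_one_2pi_int by auto
    then have "of_int n * real m = 1" using m by (simp add: field_simps)
    then have "n * int m = 1" by (metis of_int_1 of_int_eq_iff of_int_mult of_int_of_nat_eq)
    then show False using assms by (simp add: zmult_eq_1_iff)
  qed
  have ax3: "span {axis 3 1} \<in> axes (dihedral m)"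
    using fixed_space_rot[OF rotation_group_axioms mem(1) rot1] mem(1)[of 1] rot1
    unfolding axes_def by (intro image_eqI[where x = "rot (?a 1)"]) simp_all
  have axF: "?F k \<in> axes (dihedral m)" for k
    using mem(2)[of k] half_turn_neq_1 unfolding axes_def by blast
  have neq: "?F k \<noteq> span {axis 3 1}" for k
    using half_turn_axis span_base by blast
  have eq: "axes (dihedral m) = insert (span {axis 3 1}) (?F ` {0..<int m})"
  proof (intro equalityI subsetI)
    fix l assume "l \<in> axes (dihedral m)"
    then obtain g where g: "g \<in> dihedral m" "g \<noteq> mat 1" "l = fixed_space {g}"
      by (auto simp: axes_def)
    then consider k where "g = rot (?a k)" | k where "g = half_turn (?a k)" "k \<in> {0..<int m}"
      unfolding dihedral_eq[OF m] by blast
    then show "l \<in> insert (span {axis 3 1}) (?F ` {0..<int m})"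
      using fixed_space_rot[OF rotation_group_axioms mem(1)] g by cases auto
  qed (use ax3 axF in auto)
  have "inj_on ?F {0..<int m}"
  proof (rule inj_onI)
    fix j k assume jk: "j \<in> {0..<int m}" "k \<in> {0..<int m}" "?F j = ?F k"
    \<comment> \<open>Half turns with the same axis have angles congruent modulo full turns, hence
      indices congruent modulo \<open>m\<close>.\<close>
    then obtain n :: int where "?a j = ?a k + 2 * pi * n" using fixed_space_half_turn_eqD by blast
    then have "2 * pi * of_int j = 2 * pi * (of_int k + of_int n * real m)"
      using m by (simp add: field_simps)
    then have "real_of_int j = of_int k + of_int n * real m" by simp
    then have "j = k + n * int m"
      by (metis of_int_add of_int_eq_iff of_int_mult of_int_of_nat_eq)
    then have "j mod int m = k mod int m" by simp
    then show "j = k" using jk by simp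
  qed
  then have "card (?F ` {0..<int m}) = m" by (simp add: card_image)
  moreover have "span {axis 3 1} \<notin> ?F ` {0..<int m}" using neq by blast
  ultimately have "card (axes (dihedral m)) = m + 1" unfolding eq by simp
  moreover have "fixed_space (dihedral m) \<notin> axes (dihedral m)"
    using fixed_space_eq_0[OF ax3 axF[of 0]] neq[of 0] dim_axis by fastforce
  ultimately show ?thesis by simp
qed

section \<open>A group with a single axis\<close>

definition half_turn_group :: "(real^3^3) set" where
  "half_turn_group = {mat 1, half_turn 0}"

lemma rotation_group_half_turn: "rotation_group half_turn_group"
proof (rule rotation_groupI)
  have "half_turn 0 ** half_turn 0 = mat 1" by (simp add: rot_half_turn_mult rot_0)
  then show "subgroup half_turn_group GL"
    by (intro subgroup_GLI) (auto simp: half_turn_group_def)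
qed (auto simp: half_turn_group_def det_half_turn)

text \<open>The only axis is also the common fixed space, the top of the lattice, so no middle
  element is left.\<close>

lemma card_axes_half_turn: "card (axes half_turn_group - {fixed_space half_turn_group}) = 0"
proof -
  have "axes half_turn_group = {fixed_space {half_turn 0}}"
    using half_turn_neq_1 by (auto simp: axes_def half_turn_group_def)
  moreover have "fixed_space half_turn_group = fixed_space {half_turn 0}"
    by (simp add: fixed_space_def half_turn_group_def)
  ultimately show ?thesis by simp
qed

theorem theorem2:
  shows "(\<forall>G :: (real^3^3) set.
            finite G \<and> subgroup G GL \<and> strictly_generated_in_codim 2 G \<and> G \<noteq> {mat 1} \<longrightarrow>
            (\<exists>n. n \<noteq> 1 \<and> n \<noteq> 2 \<and>
               poset_isomorphic (intersection_lattice (subspace_arrangement G)) (L_poset n)))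
       \<and> (\<forall>n. n \<noteq> 1 \<and> n \<noteq> 2 \<longrightarrow>
            (\<exists>G :: (real^3^3) set.
               finite G \<and> subgroup G GL \<and> strictly_generated_in_codim 2 G \<and>
               poset_isomorphic (intersection_lattice (subspace_arrangement G)) (L_poset n)))"
proof (intro conjI allI impI)
  fix G :: "(real^3^3) set"
  assume G: "finite G \<and> subgroup G GL \<and> strictly_generated_in_codim 2 G \<and> G \<noteq> {mat 1}"
  then interpret rotation_group G by (intro rotation_group_if_strictly_generated) simp_all
  show "\<exists>n. n \<noteq> 1 \<and> n \<noteq> 2 \<and>
      poset_isomorphic (intersection_lattice (subspace_arrangement G)) (L_poset n)"
    using G intersection_lattice_iso card_axes_ne_1_2 by blast
next
  fix n :: nat assume n: "n \<noteq> 1 \<and> n \<noteq> 2"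
  obtain G :: "(real^3^3) set" where G: "rotation_group G" "G \<noteq> {mat 1}"
    "card (axes G - {fixed_space G}) = n"
  \<comment> \<open>A single axis realizes 0. For \<open>n \<ge> 3\<close> the dihedral group with
    \<open>m = n - 1\<close> has \<open>n - 1\<close> half-turn axes and the vertical one. In both
    cases a half turn shows that the group is nontrivial.\<close>
  proof (cases "n = 0")
    case True
    have "half_turn 0 \<in> half_turn_group" by (simp add: half_turn_group_def)
    then show ?thesis
      using that[OF rotation_group_half_turn] card_axes_half_turn half_turn_neq_1 True by blast
  next
    case False
    then have m: "n - 1 \<ge> 2" using n by linarith
    have "half_turn (2 * pi * of_int 0 / real (n - 1)) \<in> dihedral (n - 1)"
      unfolding dihedral_def by blast
    moreover have "rotation_group (dihedral (n - 1))"
      using m by (intro rotation_group_dihedral) simp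
    moreover have "card (axes (dihedral (n - 1)) - {fixed_space (dihedral (n - 1))}) = n"
      using card_axes_dihedral[OF m] False by simp
    ultimately show ?thesis using that half_turn_neq_1 by blast
  qed
  interpret rotation_group G by fact
  show "\<exists>G :: (real^3^3) set. finite G \<and> subgroup G GL \<and> strictly_generated_in_codim 2 G \<and>
      poset_isomorphic (intersection_lattice (subspace_arrangement G)) (L_poset n)"
    using fin sub strictly_generated intersection_lattice_iso[OF G(2)] G(3) by blast
qed

end
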